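(* Let $n\ge1$, let $(a_k)_{k\ge1}$ and $(w_k)_{k\ge 1}$ be complex numbers with $a_1=1$ and $w_1=1$, and let $A_n=W_n+D_n$, where $D_n$ is the $n\times n$ matrix whose $(i,j)$ entry is $a_{j/i}$ if $i\mid j$ and $0$ otherwise, and $W_n$ is the $n\times n$ matrix whose first column is $(0,w_2,\dots,w_n)^T$ and whose other entries are zero. Let $\lambda\neq1$ be a nontrivial eigenvalue of $A_n$ (that is, an eigenvalue different from $1$). Then $\lambda$ is a simple eigenvalue, and a basis for the one-dimensional eigenspace of $A_n$ associated with $\lambda$ is the vector $$u=\big[\lambda-1,\;X_2(\lfloor n/2\rfloor),\;X_3(\lfloor n/3\rfloor),\;X_4(\lfloor n/4\rfloor),\;\dots,\;X_n(\lfloor n/n\rfloor)\big]^T,$$ where $$X_j(q)=\sum_{k\ge0}\frac{v_j(q,k)}{(\lambda-1)^k}=w_j+\frac{v_j(q,1)}{\lambda-1}+\frac{v_j(q,2)}{(\lambda-1)^2}+\frac{v_j(q,3)}{(\lambda-1)^3}+\cdots$$ and $v_j(q,k)$ is defined in the context.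
   Context: Let $L(s)=\sum_{k=1}^{\infty}a_k k^{-s}$ be the formal Dirichlet series with coefficients $a_k$, $a_1=1$. For integers $m\ge1$ and $k\ge0$, $d(m,k)$ denotes the coefficient of $m^{-s}$ in the formal Dirichlet series $(L(s)-1)^k=\big(\sum_{m\ge2}a_m m^{-s}\big)^k=\sum_{m\ge1}d(m,k)m^{-s}$ (product = Dirichlet convolution; the $0$th power is the series $1$, so $d(1,0)=1$ and $d(m,0)=0$ for $m>1$). For $\ell\ge1$ define $v_\ell(q,k)=\sum_{1\le j\le q}w_{j\ell}\,d(j,k)$. Since $d(m,k)=0$ whenever $m<2^k$, the sums defining $X_j(q)$ are finite.
   Formalization: "Simple" is taken to mean that the eigenspace is one-dimensional; algebraic simplicity can fail: for n=4, a=(1,1,0,0), w=(1,3,0,2), λ=0 is a double root of the characteristic polynomial. *)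

theory Defs
  imports
    Complex_Main
    "Jordan_Normal_Form.Char_Poly"
    "Jordan_Normal_Form.Matrix_Kernel"
begin

text \<open>
  A formal Dirichlet series is represented by its coefficient function \<open>nat \<Rightarrow> complex\<close>, of
  which only the values at positive indices are meaningful.
\<close>

definition dirichlet_one :: "nat \<Rightarrow> complex" where
  "dirichlet_one m = (if m = 1 then 1 else 0)"

definition dirichlet_mult :: "(nat \<Rightarrow> complex) \<Rightarrow> (nat \<Rightarrow> complex) \<Rightarrow> nat \<Rightarrow> complex" where
  "dirichlet_mult f g m = (\<Sum>i | i dvd m. f i * g (m div i))"

primrec dirichlet_power :: "(nat \<Rightarrow> complex) \<Rightarrow> nat \<Rightarrow> nat \<Rightarrow> complex" where
  "dirichlet_power f 0 = dirichlet_one"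
| "dirichlet_power f (Suc k) = dirichlet_mult f (dirichlet_power f k)"

definition dcoeff :: "(nat \<Rightarrow> complex) \<Rightarrow> nat \<Rightarrow> nat \<Rightarrow> complex" where
  "dcoeff a m k = dirichlet_power (\<lambda>i. a i - dirichlet_one i) k m"

definition vsum :: "(nat \<Rightarrow> complex) \<Rightarrow> (nat \<Rightarrow> complex) \<Rightarrow> nat \<Rightarrow> nat \<Rightarrow> nat \<Rightarrow> complex" where
  "vsum a w l q k = (\<Sum>j = 1..q. w (j * l) * dcoeff a j k)"

text \<open>If \<open>a 1 = 1\<close>, this series has only finitely many nonzero terms; see \<open>Xsum_finite\<close> below.\<close>

definition Xsum :: "(nat \<Rightarrow> complex) \<Rightarrow> (nat \<Rightarrow> complex) \<Rightarrow> complex \<Rightarrow> nat \<Rightarrow> nat \<Rightarrow> complex" where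
  "Xsum a w lam j q = (\<Sum>k. vsum a w j q k / (lam - 1) ^ k)"

text \<open>
  Matrices and vectors are indexed from 0, so position \<open>(i, j)\<close> below is entry
  \<open>(i + 1, j + 1)\<close> in the usual numbering.
\<close>

definition D_mat :: "nat \<Rightarrow> (nat \<Rightarrow> complex) \<Rightarrow> complex mat" where
  "D_mat n a =
     mat n n (\<lambda>(i, j). if (i + 1) dvd (j + 1) then a ((j + 1) div (i + 1)) else 0)"

definition W_mat :: "nat \<Rightarrow> (nat \<Rightarrow> complex) \<Rightarrow> complex mat" where
  "W_mat n w = mat n n (\<lambda>(i, j). if j = 0 \<and> i \<noteq> 0 then w (i + 1) else 0)"

definition A_mat :: "nat \<Rightarrow> (nat \<Rightarrow> complex) \<Rightarrow> (nat \<Rightarrow> complex) \<Rightarrow> complex mat" where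
  "A_mat n a w = W_mat n w + D_mat n a"

definition u_vec :: "nat \<Rightarrow> (nat \<Rightarrow> complex) \<Rightarrow> (nat \<Rightarrow> complex) \<Rightarrow> complex \<Rightarrow> complex vec" where
  "u_vec n a w lam =
     vec n (\<lambda>i. if i = 0 then lam - 1 else Xsum a w lam (i + 1) (n div (i + 1)))"

text \<open>
  The eigenspace of \<open>A\<close> for \<open>lam\<close> is the kernel of \<open>char_matrix A lam\<close>, that is of
  \<open>A - lam I\<close>, as a subspace of the column vectors. Simplicity is geometric here: the
  eigenspace is a line. The algebraic multiplicity of an eigenvalue of \<open>A_mat n a w\<close> other
  than 1 can be larger. For \<open>n = 4\<close>, \<open>a = (1, 1, 0, 0)\<close>, \<open>w = (1, 3, 0, 2)\<close> the
  characteristic polynomial in \<open>t = lam - 1\<close> is \<open>t (t - 2) (t + 1)^2\<close>, so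
  \<open>lam = 0\<close> is a double root.
\<close>

abbreviation eigenspace_dim :: "complex mat \<Rightarrow> complex \<Rightarrow> nat" where
  "eigenspace_dim A lam \<equiv> kernel.dim (dim_row A) (char_matrix A lam)"

abbreviation eigenspace_basis :: "complex mat \<Rightarrow> complex \<Rightarrow> complex vec set \<Rightarrow> bool" where
  "eigenspace_basis A lam B \<equiv> kernel.basis (dim_row A) (char_matrix A lam) B"

definition simple_eigenvalue :: "complex mat \<Rightarrow> complex \<Rightarrow> bool" where
  "simple_eigenvalue A lam \<longleftrightarrow> eigenvalue A lam \<and> eigenspace_dim A lam = 1"

lemma eigenspace_eq:
  fixes A :: "complex mat"
  assumes "A \<in> carrier_mat n n"
  shows "mat_kernel (char_matrix A lam) = {v \<in> carrier_vec n. A *\<^sub>v v = lam \<cdot>\<^sub>v v}"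
proof -
  have "char_matrix A lam *\<^sub>v v = 0\<^sub>v n \<longleftrightarrow> A *\<^sub>v v = lam \<cdot>\<^sub>v v"
    if v: "v \<in> carrier_vec n" for v
  proof (cases "v = 0\<^sub>v n")
    case True
    have "B *\<^sub>v 0\<^sub>v n = 0\<^sub>v n" if "B \<in> carrier_mat n n" for B :: "complex mat"
      using that by (intro eq_vecI) auto
    from this[OF char_matrix_closed[OF assms]] this[OF assms] show ?thesis
      using True by auto
  next
    case False
    then show ?thesis
      using eigenvector_char_matrix[OF assms, of v lam] assms v by (auto simp: eigenvector_def)
  qed
  then show ?thesis
    using mat_kernel[OF char_matrix_closed[OF assms]] by auto
qed

lemma dcoeff_eq_0:
  assumes "a 1 = 1" "0 < m" "m < 2 ^ k"
  shows "dcoeff a m k = 0"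
  using assms(2,3)
proof (induction k arbitrary: m)
  case 0
  then show ?case by simp
next
  case (Suc k)
  have "(a i - dirichlet_one i) * dcoeff a (m div i) k = 0" if "i dvd m" for i
  proof (cases "i = 1")
    case True
    then show ?thesis using assms(1) by (simp add: dirichlet_one_def)
  next
    case False
    from that obtain c where c: "m = i * c" by blast
    with Suc.prems False have i: "2 \<le> i" "0 < c" by (cases i; auto)+
    then have "2 * c \<le> m" using c by simp
    with Suc.prems have "c < 2 ^ k" by simp
    then show ?thesis using Suc.IH[of c] i c by simp
  qed
  then show ?case
    by (simp add: dcoeff_def dirichlet_mult_def del: mult_eq_0_iff)
qed

lemma vsum_eq_0:
  assumes "a 1 = 1" "q < 2 ^ k"
  shows "vsum a w l q k = 0"
  unfolding vsum_def using assms by (intro sum.neutral) (auto intro!: dcoeff_eq_0)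

lemma Xsum_finite:
  assumes "a 1 = 1" "q < 2 ^ K"
  shows "Xsum a w lam j q = (\<Sum>k<K. vsum a w j q k / (lam - 1) ^ k)"
  unfolding Xsum_def
proof (rule suminf_finite)
  fix k assume "k \<notin> {..<K}"
  then have "(2::nat) ^ K \<le> 2 ^ k" by simp
  with assms(2) have "q < 2 ^ k" by linarith
  with assms(1) show "vsum a w j q k / (lam - 1) ^ k = 0"
    by (simp add: vsum_eq_0)
qed simp

lemma vsum_0:
  assumes "1 \<le> q"
  shows "vsum a w l q 0 = w l"
proof -
  have "vsum a w l q 0 = (\<Sum>j = 1..q. if j = 1 then w l else 0)"
    unfolding vsum_def by (rule sum.cong) (auto simp: dcoeff_def dirichlet_one_def)
  then show ?thesis using assms by simp
qed

end

theory Submission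
  imports Defs
begin

text \<open>
  For \<open>i \<ge> 2\<close>, row \<open>i\<close> of \<open>A x = \<lambda> x\<close> expresses
  \<open>(\<lambda> - 1) x\<^sub>i\<close> through \<open>x\<^sub>1\<close> and the entries \<open>x\<^sub>i\<^sub>m\<close> with \<open>m \<ge> 2\<close>, so for
  \<open>\<lambda> \<noteq> 1\<close> an eigenvector is determined by its first entry. The convolution
  \<open>(L - 1) (L - 1)\<^sup>k\<close> shows that the numbers \<open>X\<^sub>j(\<lfloor>n/j\<rfloor>)\<close> satisfy this recursion for the
  first entry \<open>\<lambda> - 1\<close>. Hence every eigenvector is a multiple of \<open>u\<close>. Row 1 of the equation for
  \<open>u\<close> needs no computation: it is inherited from the eigenvector that exists by hypothesis.
\<close>

lemma sum_multiples:
  fixes f :: "nat \<Rightarrow> 'a::comm_monoid_add"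
  assumes "0 < d"
  shows "(\<Sum>j \<in> {j \<in> {1..n}. d dvd j}. f j) = (\<Sum>m = 1..n div d. f (d * m))"
proof (rule sum.reindex_bij_witness[where i = "\<lambda>m. d * m" and j = "\<lambda>j. j div d"])
  fix j assume "j \<in> {j \<in> {1..n}. d dvd j}"
  then show "j div d \<in> {1..n div d}"
    using assms by (auto intro: div_le_mono simp: dvd_imp_le Suc_le_eq div_greater_zero_iff)
next
  fix m assume "m \<in> {1..n div d}"
  then show "d * m \<in> {j \<in> {1..n}. d dvd j}"
    using assms by (auto simp: less_eq_div_iff_mult_less_eq mult.commute)
qed (use assms in auto)

text \<open>Both sides run over the factorizations \<open>r = i * s\<close> with \<open>r\<close> at
  most \<open>q\<close>: on the left grouped by the product, on the right by the divisor
  \<open>i\<close>, which leaves \<open>q div i\<close> choices for the cofactor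
  \<open>s\<close>.\<close>

lemma sum_divisors_swap:
  fixes f :: "nat \<Rightarrow> nat \<Rightarrow> 'a::comm_monoid_add"
  shows "(\<Sum>r = 1..q. \<Sum>i | i dvd r. f i r) = (\<Sum>i = 1..q. \<Sum>s = 1..q div i. f i (i * s))"
proof -
  have "(\<Sum>r = 1..q. \<Sum>i | i dvd r. f i r) = (\<Sum>r = 1..q. \<Sum>i | i \<in> {1..q} \<and> i dvd r. f i r)"
  proof (intro sum.cong refl)
    fix r assume r: "r \<in> {1..q}"
    have "i \<in> {1..q}" if "i dvd r" for i
      using that r dvd_imp_le[of i r] by (cases i) auto
    then show "{i. i dvd r} = {i. i \<in> {1..q} \<and> i dvd r}" by blast
  qed
  also have "\<dots> = (\<Sum>i = 1..q. \<Sum>r | r \<in> {1..q} \<and> i dvd r. f i r)"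
    by (rule sum.swap_restrict) auto
  also have "\<dots> = (\<Sum>i = 1..q. \<Sum>s = 1..q div i. f i (i * s))"
    by (intro sum.cong refl sum_multiples) auto
  finally show ?thesis .
qed

lemma sum_remove_1:
  fixes f :: "nat \<Rightarrow> 'a::comm_monoid_add"
  assumes "1 \<le> q"
  shows "(\<Sum>m = 1..q. f m) = f 1 + (\<Sum>m = 2..q. f m)"
  using sum.atLeast_Suc_atMost[OF assms, of f] by (simp add: numeral_2_eq_2)

text \<open>This is the coefficient form of (L - 1)^(k+1) = (L - 1) (L - 1)^k. Once the summation
  index is split as \<open>m * s\<close>, the weight \<open>w (m * s * l)\<close> becomes the weight
  of \<open>s\<close> for the step \<open>l * m\<close>, so the inner sum is again a
  \<open>vsum\<close>.\<close>

lemma vsum_Suc: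
  assumes "a 1 = 1"
  shows "vsum a w l q (Suc k) = (\<Sum>m = 2..q. a m * vsum a w (l * m) (q div m) k)"
proof (cases "1 \<le> q")
  case True
  define b where "b = (\<lambda>i. a i - dirichlet_one i)"
  have "vsum a w l q (Suc k) = (\<Sum>r = 1..q. \<Sum>i | i dvd r. b i * (w (r * l) * dcoeff a (r div i) k))"
    by (simp add: vsum_def dcoeff_def dirichlet_mult_def b_def sum_distrib_left mult_ac)
  also have "\<dots> = (\<Sum>i = 1..q. \<Sum>s = 1..q div i. b i * (w (i * s * l) * dcoeff a (i * s div i) k))"
    by (rule sum_divisors_swap)
  also have "\<dots> = (\<Sum>i = 1..q. b i * vsum a w (l * i) (q div i) k)"
    unfolding vsum_def sum_distrib_left by (intro sum.cong refl) (auto simp: mult_ac)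
  \<comment> \<open>The series L - 1 has no constant term because \<open>a 1 = 1\<close>.\<close>
  also have "\<dots> = (\<Sum>i = 2..q. b i * vsum a w (l * i) (q div i) k)"
    using assms by (subst sum_remove_1[OF True]) (simp add: b_def dirichlet_one_def)
  also have "\<dots> = (\<Sum>m = 2..q. a m * vsum a w (l * m) (q div m) k)"
    by (intro sum.cong refl) (auto simp: b_def dirichlet_one_def)
  finally show ?thesis .
qed (simp add: vsum_def)

text \<open>The term \<open>k = 0\<close> of the series is \<open>w j\<close>. In the others the
  factor \<open>lam - 1\<close> lowers the exponent of the denominator by one, and
  \<open>vsum_Suc\<close> turns them into the series for the multiples \<open>j * m\<close>.\<close>

lemma Xsum_recursion:
  assumes "a 1 = 1" "lam \<noteq> 1" "1 \<le> q"
  shows "(lam - 1) * Xsum a w lam j q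
    = (lam - 1) * w j + (\<Sum>m = 2..q. a m * Xsum a w lam (j * m) (q div m))"
proof -
  \<comment> \<open>The bound \<open>q\<close> truncates the series for every \<open>q div m\<close>
    at once, so only finite sums are exchanged. The series for \<open>q\<close> itself is cut at
    \<open>Suc q\<close>, which leaves \<open>q\<close> terms after the first is split off.\<close>
  have q: "q < 2 ^ q" by (rule less_exp)
  then have q': "q < 2 ^ Suc q" unfolding power_Suc by linarith
  have "(lam - 1) * Xsum a w lam j q
      = (lam - 1) * w j + (\<Sum>k<q. vsum a w j q (Suc k) / (lam - 1) ^ k)"
    unfolding Xsum_finite[where a = a and K = "Suc q", OF assms(1) q'] sum.lessThan_Suc_shift distrib_left
      sum_distrib_left
    using assms by (simp add: vsum_0 power_Suc)
  also have "(\<Sum>k<q. vsum a w j q (Suc k) / (lam - 1) ^ k)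
      = (\<Sum>k<q. \<Sum>m = 2..q. a m * (vsum a w (j * m) (q div m) k / (lam - 1) ^ k))"
    by (simp add: vsum_Suc[where a = a, OF assms(1)] sum_divide_distrib)
  also have "\<dots> = (\<Sum>m = 2..q. a m * (\<Sum>k<q. vsum a w (j * m) (q div m) k / (lam - 1) ^ k))"
    by (subst sum.swap) (simp add: sum_distrib_left)
  also have "\<dots> = (\<Sum>m = 2..q. a m * Xsum a w lam (j * m) (q div m))"
  proof (intro sum.cong refl)
    fix m
    have "q div m < 2 ^ q" using q div_le_dividend[of q m] by linarith
    then show "a m * (\<Sum>k<q. vsum a w (j * m) (q div m) k / (lam - 1) ^ k)
        = a m * Xsum a w lam (j * m) (q div m)"
      by (simp add: Xsum_finite[where a = a and K = q, OF assms(1)])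
  qed
  finally show ?thesis .
qed

lemma A_mat_carrier: "A_mat n a w \<in> carrier_mat n n"
  by (simp add: A_mat_def W_mat_def D_mat_def)

text \<open>The shift \<open>- 1\<close> turns the usual numbering of entries into that of the library.\<close>

lemma A_mat_mult_index:
  assumes "a 1 = 1" "v \<in> carrier_vec n" "i \<in> {2..n}"
  shows "(A_mat n a w *\<^sub>v v) $ (i - 1)
    = w i * v $ 0 + v $ (i - 1) + (\<Sum>m = 2..n div i. a m * v $ (i * m - 1))"
proof -
  have i: "i - 1 < n" "i - 1 \<noteq> 0" "Suc (i - 1) = i" "0 < i" "0 < n" using assms(3) by auto
  have q: "1 \<le> n div i" using assms(3) by (auto simp: Suc_le_eq div_greater_zero_iff)
  have "(A_mat n a w *\<^sub>v v) $ (i - 1) = (\<Sum>j<n. A_mat n a w $$ (i - 1, j) * v $ j)"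
    using assms(2) i A_mat_carrier[of n a w]
    by (auto simp: scalar_prod_def lessThan_atLeast0 intro!: sum.cong)
  \<comment> \<open>The first summand comes from \<open>W_mat\<close>, whose only nonzero column is
    the first, and the second from \<open>D_mat\<close>.\<close>
  also have "\<dots> = (\<Sum>j<n. (if j = 0 then w i * v $ 0 else 0)
      + (if i dvd Suc j then a (Suc j div i) * v $ j else 0))"
    using i by (intro sum.cong refl) (auto simp: A_mat_def W_mat_def D_mat_def distrib_right)
  also have "\<dots> = w i * v $ 0 + (\<Sum>j<n. if i dvd Suc j then a (Suc j div i) * v $ j else 0)"
    using i by (simp add: sum.distrib)
  also have "(\<Sum>j<n. if i dvd Suc j then a (Suc j div i) * v $ j else 0)
      = (\<Sum>j = 1..n. if i dvd j then a (j div i) * v $ (j - 1) else 0)"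
    by (rule sum.reindex_bij_witness[where i = "\<lambda>j. j - 1" and j = Suc]) auto
  also have "\<dots> = (\<Sum>j \<in> {j \<in> {1..n}. i dvd j}. a (j div i) * v $ (j - 1))"
    by (rule sum.inter_filter[symmetric]) simp
  also have "\<dots> = (\<Sum>m = 1..n div i. a m * v $ (i * m - 1))"
    using i by (subst sum_multiples) simp_all
  \<comment> \<open>The term \<open>m = 1\<close> is the diagonal entry \<open>a 1 = 1\<close> of
    \<open>D_mat\<close>.\<close>
  also have "\<dots> = v $ (i - 1) + (\<Sum>m = 2..n div i. a m * v $ (i * m - 1))"
    using assms(1) by (subst sum_remove_1[OF q]) simp
  finally show ?thesis by (simp add: add.assoc)
qed

lemma eigenvector_multiple_of_u:
  assumes "a 1 = 1" "lam \<noteq> 1" "1 \<le> n"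
    and v: "v \<in> carrier_vec n" "A_mat n a w *\<^sub>v v = lam \<cdot>\<^sub>v v"
  shows "v = (v $ 0 / (lam - 1)) \<cdot>\<^sub>v u_vec n a w lam"
proof -
  \<comment> \<open>The first entry of \<open>u_vec\<close> is \<open>lam - 1\<close>, so this is
    the only scale that can work.\<close>
  define c where "c = v $ 0 / (lam - 1)"
  have c: "c * (lam - 1) = v $ 0" using assms(2) by (simp add: c_def)
  have entry: "v $ (i - 1) = c * Xsum a w lam i (n div i)" if "i \<in> {2..n}" for i
    using that
  \<comment> \<open>Row \<open>i\<close> refers, apart from the entries 1 and \<open>i\<close>, only
    to entries at proper multiples of \<open>i\<close>, so the induction descends from
    \<open>n\<close>. For \<open>2 * i > n\<close> the sum over \<open>m\<close> is empty.\<close>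
  proof (induction "n - i" arbitrary: i rule: less_induct)
    case less
    have q: "1 \<le> n div i" using less.prems by (auto simp: Suc_le_eq div_greater_zero_iff)
    have IH: "v $ (i * m - 1) = c * Xsum a w lam (i * m) (n div i div m)"
      if "m \<in> {2..n div i}" for m
    proof -
      have "i * m \<le> n"
        using that less.prems by (auto simp: less_eq_div_iff_mult_less_eq mult.commute)
      moreover have "i * 2 \<le> i * m" using that by (intro mult_le_mono) auto
      ultimately have "i * m \<in> {2..n}" "n - i * m < n - i"
        using less.prems unfolding atLeastAtMost_iff by linarith+
      \<comment> \<open>Nested floors collapse: \<open>n div (i * m) = n div i div m\<close>. This
        matches the argument in \<open>Xsum_recursion\<close>.\<close>
      then show ?thesis using less.hyps[of "i * m"] by (simp add: div_mult2_eq)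
    qed
    have "lam * v $ (i - 1) = (A_mat n a w *\<^sub>v v) $ (i - 1)"
      using v less.prems by auto
    also have "\<dots> = w i * v $ 0 + v $ (i - 1) + (\<Sum>m = 2..n div i. a m * v $ (i * m - 1))"
      by (rule A_mat_mult_index[where a = a, OF assms(1) v(1) less.prems])
    also have "(\<Sum>m = 2..n div i. a m * v $ (i * m - 1))
        = c * (\<Sum>m = 2..n div i. a m * Xsum a w lam (i * m) (n div i div m))"
      unfolding sum_distrib_left by (intro sum.cong refl) (simp only: IH mult.left_commute)
    finally have "(lam - 1) * v $ (i - 1) = c * ((lam - 1) * w i
        + (\<Sum>m = 2..n div i. a m * Xsum a w lam (i * m) (n div i div m)))"
      by (simp add: c[symmetric] algebra_simps)
    also have "\<dots> = (lam - 1) * (c * Xsum a w lam i (n div i))"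
      by (simp add: Xsum_recursion[where a = a, OF assms(1,2) q, symmetric])
    finally show ?case using assms(2) by simp
  qed
  have "v = c \<cdot>\<^sub>v u_vec n a w lam"
  proof (rule eq_vecI)
    fix i assume "i < dim_vec (c \<cdot>\<^sub>v u_vec n a w lam)"
    then have "i < n" by (simp add: u_vec_def)
    then show "v $ i = (c \<cdot>\<^sub>v u_vec n a w lam) $ i"
      using entry[of "Suc i"] c by (cases "i = 0") (auto simp: u_vec_def)
  qed (use v in \<open>simp add: u_vec_def\<close>)
  then show ?thesis by (simp add: c_def)
qed

text \<open>This carries the elementary description of a line over to the library's notions of basis
  and dimension. The hypothesis \<open>line\<close> gives spanning, and \<open>v\<close> being
  nonzero gives independence.\<close>

lemma kernel_singleton_basis:
  assumes "A \<in> carrier_mat nr nc" "v \<in> mat_kernel A" "v \<noteq> 0\<^sub>v nc"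
    and line: "\<And>x. x \<in> mat_kernel A \<Longrightarrow> \<exists>c. x = c \<cdot>\<^sub>v v"
  shows "kernel.basis nc A {v} \<and> kernel.dim nc A = 1"
proof -
  interpret kernel nr nc A by unfold_locales (rule assms(1))
  have lincomb: "lincomb f {v} = f v \<cdot>\<^sub>v v" for f
  proof (rule eq_vecI)
    have "lincomb f {v} \<in> mat_kernel A"
      using Ker.lincomb_closed[of "{v}" f] assms(2) by auto
    then have d: "dim_vec (lincomb f {v}) = nc" "dim_vec v = nc"
      using mat_kernelD[OF A] assms(2) by auto
    show "dim_vec (lincomb f {v}) = dim_vec (f v \<cdot>\<^sub>v v)" using d by simp
    fix i assume "i < dim_vec (f v \<cdot>\<^sub>v v)"
    then show "lincomb f {v} $ i = (f v \<cdot>\<^sub>v v) $ i"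
      using d assms(2) by (simp add: lincomb_index)
  qed
  have "x \<in> span {v}" if x: "x \<in> mat_kernel A" for x
  proof -
    obtain c where "x = c \<cdot>\<^sub>v v" using line[OF x] by blast
    then have "x = lincomb (\<lambda>_. c) {v}" by (simp add: lincomb)
    then show ?thesis unfolding Ker.span_def by blast
  qed
  moreover have "span {v} \<subseteq> mat_kernel A"
    using Ker.span_closed[of "{v}"] assms(2) by auto
  ultimately have gen: "span {v} = mat_kernel A" by blast
  have "f v = 0" if "f v \<cdot>\<^sub>v v = 0\<^sub>v nc" for f :: "'a vec \<Rightarrow> 'a"
  proof (rule ccontr)
    assume "f v \<noteq> 0"
    then have "v = (inverse (f v) * f v) \<cdot>\<^sub>v v" by simp
    also have "\<dots> = inverse (f v) \<cdot>\<^sub>v 0\<^sub>v nc"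
      unfolding smult_smult_assoc[symmetric] that ..
    finally show False using assms(3) by simp
  qed
  then have "\<not> lin_dep {v}"
    using assms(2)
    by (intro Ker.finite_lin_indpt2) (auto simp: lincomb)
  then have "basis {v}" using gen assms(2) unfolding Ker.basis_def by auto
  then show ?thesis using Ker.dim_basis[of "{v}"] by simp
qed

theorem theorem4p1:
  fixes n :: nat and a w :: "nat \<Rightarrow> complex" and lam :: complex
  assumes "n \<ge> 1"
    and "a 1 = 1"
    and "w 1 = 1"
    and "eigenvalue (A_mat n a w) lam"
    and "lam \<noteq> 1"
  shows "simple_eigenvalue (A_mat n a w) lam
    \<and> eigenspace_basis (A_mat n a w) lam {u_vec n a w lam}"
proof -
  let ?A = "A_mat n a w" and ?u = "u_vec n a w lam"
  have A: "?A \<in> carrier_mat n n" by (rule A_mat_carrier)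
  have ker: "mat_kernel (char_matrix ?A lam) = {v \<in> carrier_vec n. ?A *\<^sub>v v = lam \<cdot>\<^sub>v v}"
    by (rule eigenspace_eq[OF A])
  have multiple: "x = (x $ 0 / (lam - 1)) \<cdot>\<^sub>v ?u" if "x \<in> mat_kernel (char_matrix ?A lam)" for x
    using that assms by (intro eigenvector_multiple_of_u) (auto simp: ker)
  have u: "?u \<in> carrier_vec n" by (simp add: u_vec_def)
  obtain v where v: "v \<in> carrier_vec n" "v \<noteq> 0\<^sub>v n" "?A *\<^sub>v v = lam \<cdot>\<^sub>v v"
    using assms(4) A by (auto simp: eigenvalue_def eigenvector_def)
  define c where "c = v $ 0 / (lam - 1)"
  have vc: "v = c \<cdot>\<^sub>v ?u" using multiple[of v] v unfolding ker c_def by simp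
  \<comment> \<open>Since \<open>c\<close> is invertible, \<open>u_vec\<close> is in turn a multiple
    of the eigenvector \<open>v\<close> and so satisfies every row of the equation, the first
    included.\<close>
  with v(2) u have "c \<noteq> 0" by auto
  then have uv: "?u = inverse c \<cdot>\<^sub>v v" by (simp add: vc smult_smult_assoc)
  have "?A *\<^sub>v ?u = inverse c \<cdot>\<^sub>v (lam \<cdot>\<^sub>v v)"
    unfolding uv v(3)[symmetric] by (rule mult_mat_vec[OF A v(1)])
  also have "\<dots> = lam \<cdot>\<^sub>v ?u" by (simp add: uv smult_smult_assoc mult.commute)
  finally have "?u \<in> mat_kernel (char_matrix ?A lam)" unfolding ker using u by simp
  moreover have "?u \<noteq> 0\<^sub>v n"
  proof
    assume "?u = 0\<^sub>v n"
    then have "?u $ 0 = 0" using assms(1) by simp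
    then show False using assms(1,5) by (simp add: u_vec_def)
  qed
  ultimately have "eigenspace_basis ?A lam {?u} \<and> eigenspace_dim ?A lam = 1"
    using kernel_singleton_basis[OF char_matrix_closed[OF A], where v = ?u] multiple
      carrier_matD(1)[OF A] by (metis (no_types))
  then show ?thesis using assms(4) by (simp add: simple_eigenvalue_def)
qed

end
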